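(* There is an absolute constant $C>0$ such that the following holds. Let an $n$-qubit system be divided into $m\ge 2$ parts. Every Schmidt decomposable state $|\psi\rangle$ of this $m$-partite system, with Schmidt rank $r_S$, can be prepared from the all-zero state $|0\rangle^{\otimes n}$ by a circuit, without ancilla qubits, consisting of arbitrary unitaries within the individual parts and at most $C\,m\,r_S$ straddling gates. That is, $|\psi\rangle$ can be prepared with $O(m r_S)$ straddling gates.
   Context: An $m$-partite pure state is Schmidt decomposable if it can be written as $$|\psi\rangle=\sum_i w_i\,|\psi_1^i\rangle\otimes|\psi_2^i\rangle\otimes\cdots\otimes|\psi_m^i\rangle,$$ where, for each party $j$, the vectors $\{|\psi_j^i\rangle\}_i$ form an orthonormal family in the Hilbert space of party $j$. Its Schmidt rank $r_S$ is the number of nonzero weights $w_i$ in this decomposition. A straddling gate is a two-qubit gate (any element of $\mathrm{SU}(4)$) acting on two qubits that belong to different parts. Unitaries acting only on the qubits of a single part are free and are not counted. *)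

theory Defs
  imports "HOL-Analysis.Analysis" "HOL-Library.Disjoint_Sets"
begin

text \<open>
  Qubits are natural numbers. The computational basis of the qubits in \<open>S\<close> is labelled by
  \<open>bitstrings S\<close>, i.e. by bit assignments that are \<open>False\<close> off \<open>S\<close>, and a vector of the
  Hilbert space of \<open>S\<close> is an amplitude function that vanishes off \<open>bitstrings S\<close>.
  Hence equality of vectors is plain equality of functions.
\<close>

type_synonym bits = "nat \<Rightarrow> bool"
type_synonym qvec = "bits \<Rightarrow> complex"

definition bitstrings :: "nat set \<Rightarrow> bits set" where
  "bitstrings S = {x. \<forall>q. x q \<longrightarrow> q \<in> S}"

definition restrict_bits :: "nat set \<Rightarrow> bits \<Rightarrow> bits" where
  "restrict_bits S x = (\<lambda>q. q \<in> S \<and> x q)"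

definition hilbert :: "nat set \<Rightarrow> qvec set" where
  "hilbert S = {\<psi>. \<forall>x. x \<notin> bitstrings S \<longrightarrow> \<psi> x = 0}"

definition qinner :: "nat set \<Rightarrow> qvec \<Rightarrow> qvec \<Rightarrow> complex" where
  "qinner S \<phi> \<psi> = (\<Sum>x\<in>bitstrings S. cnj (\<phi> x) * \<psi> x)"

definition pure_state :: "nat set \<Rightarrow> qvec \<Rightarrow> bool" where
  "pure_state S \<psi> \<longleftrightarrow> \<psi> \<in> hilbert S \<and> qinner S \<psi> \<psi> = 1"

definition zero_state :: qvec where
  "zero_state x = (if x = (\<lambda>_. False) then 1 else 0)"

definition orthonormal_family :: "nat set \<Rightarrow> nat \<Rightarrow> (nat \<Rightarrow> qvec) \<Rightarrow> bool" where
  "orthonormal_family S N f \<longleftrightarrow>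
     (\<forall>i<N. f i \<in> hilbert S) \<and>
     (\<forall>i<N. \<forall>j<N. qinner S (f i) (f j) = (if i = j then 1 else 0))"

text \<open>A division into parts is a set \<open>P\<close> of disjoint nonempty sets of qubits; the parties are
  indexed by the parts themselves.\<close>

definition tensor :: "nat set set \<Rightarrow> (nat set \<Rightarrow> qvec) \<Rightarrow> qvec" where
  "tensor P f x =
     (if x \<in> bitstrings (\<Union>P) then \<Prod>B\<in>P. f B (restrict_bits B x) else 0)"

definition schmidt_decomposition ::
  "nat set set \<Rightarrow> qvec \<Rightarrow> nat \<Rightarrow> (nat \<Rightarrow> complex) \<Rightarrow> (nat set \<Rightarrow> nat \<Rightarrow> qvec) \<Rightarrow> bool" where
  "schmidt_decomposition P \<psi> N w \<phi> \<longleftrightarrow>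
     (\<forall>B\<in>P. orthonormal_family B N (\<phi> B)) \<and>
     \<psi> = (\<lambda>x. \<Sum>i<N. w i * tensor P (\<lambda>B. \<phi> B i) x)"

definition schmidt_rank :: "nat \<Rightarrow> (nat \<Rightarrow> complex) \<Rightarrow> nat" where
  "schmidt_rank N w = card {i. i < N \<and> w i \<noteq> 0}"

definition unitary_on :: "nat set \<Rightarrow> (bits \<Rightarrow> bits \<Rightarrow> complex) \<Rightarrow> bool" where
  "unitary_on S U \<longleftrightarrow>
     (\<forall>x\<in>bitstrings S. \<forall>y\<in>bitstrings S.
        (\<Sum>z\<in>bitstrings S. cnj (U z x) * U z y) = (if x = y then 1 else 0) \<and>
        (\<Sum>z\<in>bitstrings S. U x z * cnj (U y z)) = (if x = y then 1 else 0))"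

text \<open>The index type \<open>bool \<times> bool\<close> has the four elements 00, 01, 10, 11.\<close>

type_synonym mat4 = "complex ^ (bool \<times> bool) ^ (bool \<times> bool)"

definition adjoint4 :: "mat4 \<Rightarrow> mat4" where
  "adjoint4 U = (\<chi> i j. cnj (U $ j $ i))"

definition SU4 :: "mat4 set" where
  "SU4 = {U. adjoint4 U ** U = mat 1 \<and> U ** adjoint4 U = mat 1 \<and> det U = 1}"

datatype gate =
    Local "nat set" "bits \<Rightarrow> bits \<Rightarrow> complex"
  | Straddling nat nat mat4

text \<open>Each gate acts as its matrix on its own qubits and as the identity on all others.\<close>

fun apply_gate :: "gate \<Rightarrow> qvec \<Rightarrow> qvec" where
  "apply_gate (Local S U) \<psi> =
     (\<lambda>x. \<Sum>y\<in>bitstrings S. U (restrict_bits S x) y * \<psi> (override_on x y S))"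
| "apply_gate (Straddling a b U) \<psi> =
     (\<lambda>x. \<Sum>(c, d)\<in>UNIV. U $ (x a, x b) $ (c, d) * \<psi> (x(a := c, b := d)))"

fun valid_gate :: "nat set set \<Rightarrow> gate \<Rightarrow> bool" where
  "valid_gate P (Local S U) \<longleftrightarrow> S \<in> P \<and> unitary_on S U"
| "valid_gate P (Straddling a b U) \<longleftrightarrow>
     (\<exists>A\<in>P. \<exists>B\<in>P. A \<noteq> B \<and> a \<in> A \<and> b \<in> B) \<and> U \<in> SU4"

fun is_straddling :: "gate \<Rightarrow> bool" where
  "is_straddling (Local S U) = False"
| "is_straddling (Straddling a b U) = True"

text \<open>The head of the list is the gate applied first.\<close>

definition run_circuit :: "gate list \<Rightarrow> qvec \<Rightarrow> qvec" where
  "run_circuit gs = fold apply_gate gs"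

definition straddling_count :: "gate list \<Rightarrow> nat" where
  "straddling_count gs = length (filter is_straddling gs)"

end

theory Submission
  imports Defs
begin

text \<open>
  Only the \<open>r\<close> basis labels that occur in the decomposition matter, and every part has dimension
  at least \<open>r\<close>. With \<open>k\<close> the least number such that \<open>r \<le> 2 ^ k\<close>, every part contains \<open>k\<close>
  qubits on which these labels can be encoded as distinct bit patterns. Free gates on one part
  prepare the superposition of the encoded labels with the weights of the decomposition; \<open>k\<close>
  controlled gates per remaining part copy the labels; finally, free gates within each part rotate
  the encoded labels to the Schmidt vectors. This uses \<open>(m - 1) k \<le> m r\<close> straddling gates.
  The local rotations are products of complex reflections, so no orthonormal family has to be
  completed to a basis.
\<close>

section \<open>Bit strings and inner products\<close>

lemma bij_betw_bitstrings: "bij_betw Collect (bitstrings S) (Pow S)"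
  by (rule bij_betw_byWitness[where f' = "\<lambda>X x. x \<in> X"]) (auto simp: bitstrings_def)

lemma finite_bitstrings: "finite S \<Longrightarrow> finite (bitstrings S)"
  using bij_betw_finite[OF bij_betw_bitstrings] by blast

lemma card_bitstrings: "finite S \<Longrightarrow> card (bitstrings S) = 2 ^ card S"
  using bij_betw_same_card[OF bij_betw_bitstrings] by (simp add: card_Pow)

lemma restrict_bits_in [simp]: "restrict_bits S x \<in> bitstrings S"
  by (simp add: restrict_bits_def bitstrings_def)

lemma cnj_qinner: "cnj (qinner S u v) = qinner S v u"
  by (simp add: qinner_def mult.commute)

lemma qinner_diff_left: "qinner S (\<lambda>x. u x - v x) t = qinner S u t - qinner S v t"
  by (simp add: qinner_def algebra_simps sum_subtractf)

lemma qinner_diff_right: "qinner S t (\<lambda>x. u x - v x) = qinner S t u - qinner S t v"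
  by (simp add: qinner_def algebra_simps sum_subtractf)

lemma qinner_scale_left: "qinner S (\<lambda>x. a * u x) v = cnj a * qinner S u v"
  by (simp add: qinner_def sum_distrib_left mult_ac)

lemma qinner_scale_right: "qinner S u (\<lambda>x. a * v x) = a * qinner S u v"
  by (simp add: qinner_def sum_distrib_left mult_ac)

lemma qinner_sum_left: "qinner S (\<lambda>x. \<Sum>i\<in>I. f i x) v = (\<Sum>i\<in>I. qinner S (f i) v)"
  by (simp add: qinner_def sum_distrib_right) (rule sum.swap)

lemma qinner_sum_right: "qinner S v (\<lambda>x. \<Sum>i\<in>I. f i x) = (\<Sum>i\<in>I. qinner S v (f i))"
  by (simp add: qinner_def sum_distrib_left) (rule sum.swap)

text \<open>Writing the squared norm as an embedded real sum makes order arguments available for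
  complex-valued inner products.\<close>

lemma qinner_self: "qinner S v v = of_real (\<Sum>x\<in>bitstrings S. (cmod (v x))\<^sup>2)"
  by (simp add: qinner_def complex_norm_square mult.commute del: of_real_power)

lemma qinner_eq_0_imp:
  assumes "finite S" "v \<in> hilbert S" "qinner S v v = 0"
  shows "v x = 0"
proof (cases "x \<in> bitstrings S")
  case True
  have "(\<Sum>x\<in>bitstrings S. (cmod (v x))\<^sup>2) = 0"
    using assms(3) unfolding qinner_self of_real_eq_0_iff .
  then show ?thesis
    using True finite_bitstrings[OF assms(1)] by (simp add: sum_nonneg_eq_0_iff)
next
  case False
  then show ?thesis using assms(2) by (simp add: hilbert_def)
qed

section \<open>Computational basis vectors\<close>

definition ket :: "bits \<Rightarrow> qvec" where
  "ket z x = (if x = z then 1 else 0)"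

lemma zero_state_ket: "zero_state = ket (\<lambda>_. False)"
  by (simp add: fun_eq_iff zero_state_def ket_def)

lemma ket_in_hilbert: "z \<in> bitstrings S \<Longrightarrow> ket z \<in> hilbert S"
  by (auto simp: ket_def hilbert_def)

lemma qinner_ket_right:
  "finite S \<Longrightarrow> x \<in> bitstrings S \<Longrightarrow> qinner S v (ket x) = cnj (v x)"
  by (simp add: qinner_def ket_def finite_bitstrings if_distrib cong: if_cong)

section \<open>Orthonormal families\<close>

text \<open>The index set is arbitrary because the labels of nonzero weight need not form an initial
  segment, and because a single state is later treated as a family indexed by
  \<open>{()}\<close>.\<close>

definition orthonormal_on :: "nat set \<Rightarrow> 'i set \<Rightarrow> ('i \<Rightarrow> qvec) \<Rightarrow> bool" where
  "orthonormal_on S I f \<longleftrightarrow> (\<forall>i\<in>I. f i \<in> hilbert S) \<and>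
     (\<forall>i\<in>I. \<forall>j\<in>I. qinner S (f i) (f j) = (if i = j then 1 else 0))"

lemma orthonormal_on_kets:
  assumes "finite S" "inj_on z I" "\<And>i. i \<in> I \<Longrightarrow> z i \<in> bitstrings S"
  shows "orthonormal_on S I (\<lambda>i. ket (z i))"
  using assms by (auto simp: orthonormal_on_def ket_in_hilbert qinner_ket_right inj_on_eq_iff)
    (auto simp: ket_def inj_on_eq_iff)

text \<open>Orthonormality kills the cross terms. This serves the dimension bound, the normalization
  of the Schmidt weights and the norm of the encoded superposition.\<close>

lemma qinner_superposition:
  assumes "finite I" "orthonormal_on S I f"
  shows "qinner S (\<lambda>x. \<Sum>i\<in>I. w i * f i x) (\<lambda>x. \<Sum>i\<in>I. w i * f i x) = (\<Sum>i\<in>I. cnj (w i) * w i)"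
proof -
  have "qinner S (\<lambda>x. \<Sum>i\<in>I. w i * f i x) (\<lambda>x. \<Sum>i\<in>I. w i * f i x)
      = (\<Sum>i\<in>I. \<Sum>j\<in>I. cnj (w i) * w j * qinner S (f i) (f j))"
    by (simp add: qinner_sum_left qinner_sum_right qinner_scale_left qinner_scale_right
        sum_distrib_left mult_ac)
  also have "\<dots> = (\<Sum>i\<in>I. \<Sum>j\<in>I. if i = j then cnj (w i) * w j else 0)"
    using assms(2) by (intro sum.cong refl) (auto simp: orthonormal_on_def)
  also have "\<dots> = (\<Sum>i\<in>I. cnj (w i) * w i)"
    using assms(1) by simp
  finally show ?thesis .
qed

text \<open>The projection \<open>p\<close> of \<open>ket x\<close> onto the span satisfies \<open>p x = \<parallel>p\<parallel>\<^sup>2 \<ge> (p x)\<^sup>2\<close>, so \<open>p x \<le> 1\<close>;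
  the sum of these values over all \<open>x\<close> is the size of the family.\<close>

lemma card_orthonormal_le:
  assumes S: "finite S" and I: "finite I" and f: "orthonormal_on S I f"
  shows "card I \<le> 2 ^ card S"
proof -
  have fin: "finite (bitstrings S)" by (rule finite_bitstrings[OF S])
  have le1: "(\<Sum>i\<in>I. (cmod (f i x))\<^sup>2) \<le> 1" if x: "x \<in> bitstrings S" for x
  proof -
    define s where "s = (\<Sum>i\<in>I. (cmod (f i x))\<^sup>2)"
    define p where "p = (\<lambda>y. \<Sum>i\<in>I. cnj (f i x) * f i y)"
    have s0: "0 \<le> s" unfolding s_def by (intro sum_nonneg) simp
    have px: "p x = of_real s"
      by (simp add: p_def s_def complex_norm_square mult.commute del: of_real_power)
    have "qinner S p p = of_real s"
      unfolding p_def qinner_superposition[OF I f]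
      by (simp add: s_def complex_norm_square mult.commute del: of_real_power)
    then have "(\<Sum>y\<in>bitstrings S. (cmod (p y))\<^sup>2) = s"
      unfolding qinner_self of_real_eq_iff .
    moreover have "(cmod (p x))\<^sup>2 \<le> (\<Sum>y\<in>bitstrings S. (cmod (p y))\<^sup>2)"
      by (rule member_le_sum[OF x _ fin]) simp
    ultimately have "s * s \<le> s * 1" using s0 by (simp add: px power2_eq_square)
    then have "s \<le> 1" using s0 by (cases "s = 0") (auto simp: mult_le_cancel_left)
    then show ?thesis by (simp add: s_def)
  qed
  have one: "(\<Sum>x\<in>bitstrings S. (cmod (f i x))\<^sup>2) = 1" if "i \<in> I" for i
    using f that qinner_self[of S "f i"] unfolding orthonormal_on_def by (metis of_real_eq_1_iff)
  have "real (card I) = (\<Sum>i\<in>I. \<Sum>x\<in>bitstrings S. (cmod (f i x))\<^sup>2)"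
    by (simp add: one)
  also have "\<dots> = (\<Sum>x\<in>bitstrings S. \<Sum>i\<in>I. (cmod (f i x))\<^sup>2)"
    by (rule sum.swap)
  also have "\<dots> \<le> (\<Sum>x\<in>bitstrings S. 1)"
    by (intro sum_mono le1)
  also have "\<dots> = real (2 ^ card S)"
    by (simp add: card_bitstrings[OF S])
  finally show ?thesis by (simp only: of_nat_le_iff)
qed

section \<open>Complex reflections\<close>

text \<open>The pair \<open>(w, c)\<close> encodes the operator \<open>1 - c |w><w|\<close>, with
  \<open>w\<close> not normalized and \<open>c\<close> complex.\<close>

definition reflect :: "nat set \<Rightarrow> qvec \<times> complex \<Rightarrow> qvec \<Rightarrow> qvec" where
  "reflect S r v = (\<lambda>x. v x - snd r * qinner S (fst r) v * fst r x)"

text \<open>The condition on \<open>c\<close> is what makes \<open>1 - c w w\<^sup>*\<close> unitary.\<close>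

definition reflector :: "nat set \<Rightarrow> qvec \<times> complex \<Rightarrow> bool" where
  "reflector S r \<longleftrightarrow> fst r \<in> hilbert S \<and>
     snd r + cnj (snd r) = snd r * cnj (snd r) * qinner S (fst r) (fst r)"

definition reflect_matrix :: "qvec \<times> complex \<Rightarrow> bits \<Rightarrow> bits \<Rightarrow> complex" where
  "reflect_matrix r x y = ket y x - snd r * fst r x * cnj (fst r y)"

lemma reflect_in_hilbert: "reflector S r \<Longrightarrow> v \<in> hilbert S \<Longrightarrow> reflect S r v \<in> hilbert S"
  by (simp add: reflector_def reflect_def hilbert_def)

text \<open>Expanding both sides leaves an error with the factor
  \<open>c + cnj c - c * cnj c * qinner S w w\<close>, which vanishes for a reflector.\<close>

lemma qinner_reflect:
  assumes "reflector S r"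
  shows "qinner S (reflect S r u) (reflect S r v) = qinner S u v"
proof -
  obtain w c where r: "r = (w, c)" by fastforce
  have c: "c + cnj c = c * cnj c * qinner S w w"
    using assms by (simp add: reflector_def r)
  have "qinner S (reflect S r u) (reflect S r v)
      = qinner S u v - qinner S u w * qinner S w v * (c + cnj c - c * cnj c * qinner S w w)"
    by (simp add: reflect_def r qinner_diff_left qinner_diff_right qinner_scale_left
        qinner_scale_right cnj_qinner) (simp add: algebra_simps)
  then show ?thesis by (simp add: c)
qed

text \<open>Columns are images of basis vectors under the reflection, and conjugated rows are images
  under its adjoint. Both maps preserve inner products, which gives the two unitarity
  relations.\<close>

lemma unitary_reflect_matrix:
  assumes S: "finite S" and r: "reflector S r"
  shows "unitary_on S (reflect_matrix r)"
proof -
  obtain w c where wc: "r = (w, c)" by fastforce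
  \<comment> \<open>The adjoint reflection has parameter \<open>cnj c\<close>, and the reflector
    condition is symmetric in \<open>c\<close> and \<open>cnj c\<close>.\<close>
  have r': "reflector S (w, cnj c)"
    using r by (simp add: reflector_def wc algebra_simps)
  have col: "reflect_matrix r z x = reflect S r (ket x) z" if "x \<in> bitstrings S" for x z
    using that S by (simp add: reflect_matrix_def reflect_def qinner_ket_right mult_ac)
  have row: "cnj (reflect_matrix r x z) = reflect S (w, cnj c) (ket x) z"
    if "x \<in> bitstrings S" for x z
    using that S by (auto simp: wc reflect_matrix_def reflect_def qinner_ket_right ket_def mult_ac)
  have id: "qinner S (ket x) (ket y) = (if x = y then 1 else 0)"
    if "y \<in> bitstrings S" for x y
    using that S by (simp add: qinner_ket_right) (simp add: ket_def)
  show ?thesis unfolding unitary_on_def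
  proof (intro ballI conjI)
    fix x y assume x: "x \<in> bitstrings S" and y: "y \<in> bitstrings S"
    have "(\<Sum>z\<in>bitstrings S. cnj (reflect_matrix r z x) * reflect_matrix r z y)
        = qinner S (reflect S r (ket x)) (reflect S r (ket y))"
      by (simp add: qinner_def col x y)
    then show "(\<Sum>z\<in>bitstrings S. cnj (reflect_matrix r z x) * reflect_matrix r z y)
        = (if x = y then 1 else 0)"
      by (simp add: qinner_reflect[OF r] id[OF y])
    have "(\<Sum>z\<in>bitstrings S. reflect_matrix r x z * cnj (reflect_matrix r y z))
        = qinner S (reflect S (w, cnj c) (ket x)) (reflect S (w, cnj c) (ket y))"
      by (simp add: qinner_def flip: row[OF x] row[OF y])
    then show "(\<Sum>z\<in>bitstrings S. reflect_matrix r x z * cnj (reflect_matrix r y z))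
        = (if x = y then 1 else 0)"
      by (simp add: qinner_reflect[OF r'] id[OF y])
  qed
qed

lemma reflect_matrix_apply:
  assumes "finite S" "x \<in> bitstrings S"
  shows "(\<Sum>y\<in>bitstrings S. reflect_matrix r x y * v y) = reflect S r v x"
proof -
  have "reflect_matrix r x y * v y
      = (if x = y then v y else 0) - snd r * (cnj (fst r y) * v y) * fst r x" for y
    by (simp add: reflect_matrix_def ket_def algebra_simps)
  then have "(\<Sum>y\<in>bitstrings S. reflect_matrix r x y * v y)
      = (\<Sum>y\<in>bitstrings S. if x = y then v y else 0) - snd r * qinner S (fst r) v * fst r x"
    by (simp add: qinner_def sum_subtractf sum_distrib_left sum_distrib_right)
  then show ?thesis
    using assms by (simp add: finite_bitstrings reflect_def)
qed

text \<open>For \<open>w = u - g\<close>, subtracting exactly \<open>w\<close> from \<open>u\<close>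
  forces \<open>c = 1 / qinner S w u\<close>. Since \<open>u\<close> and \<open>g\<close> are unit
  vectors, this \<open>c\<close> satisfies the reflector condition even when
  \<open>qinner S g u\<close> is not real.\<close>

lemma exists_reflector:
  assumes S: "finite S" and u: "u \<in> hilbert S" "qinner S u u = 1"
    and g: "g \<in> hilbert S" "qinner S g g = 1"
  obtains c where "reflector S (\<lambda>x. u x - g x, c)" "reflect S (\<lambda>x. u x - g x, c) u = g"
proof -
  define w where "w = (\<lambda>x. u x - g x)"
  define \<alpha> where "\<alpha> = qinner S w u"
  have w: "w \<in> hilbert S" using u g by (simp add: w_def hilbert_def)
  have \<alpha>: "\<alpha> = 1 - qinner S g u" by (simp add: \<alpha>_def w_def qinner_diff_left u)
  have ww: "qinner S w w = \<alpha> + cnj \<alpha>"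
    by (simp add: w_def \<alpha> qinner_diff_left qinner_diff_right u g cnj_qinner)
  \<comment> \<open>If \<open>\<alpha> = 0\<close>, division by zero yields the coefficient
    \<open>0\<close> and the reflection is the identity; this is correct, because \<open>w\<close>
    then has norm zero and \<open>u = g\<close>.\<close>
  have "reflector S (w, 1 / \<alpha>)"
    using w by (cases "\<alpha> = 0") (simp_all add: reflector_def ww field_simps)
  moreover have "reflect S (w, 1 / \<alpha>) u = g"
  proof (cases "\<alpha> = 0")
    case True
    then have "w x = 0" for x
      using qinner_eq_0_imp[OF S w] ww by simp
    then have "u = g" by (simp add: w_def fun_eq_iff)
    then show ?thesis using True by (simp add: reflect_def)
  next
    case False
    then show ?thesis by (simp add: reflect_def flip: \<alpha>_def) (simp add: w_def)
  qed
  ultimately show ?thesis using that unfolding w_def by blast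
qed

lemma fold_reflect:
  assumes "\<forall>r\<in>set rs. reflector S r"
  shows "v \<in> hilbert S \<Longrightarrow> fold (reflect S) rs v \<in> hilbert S"
    and "qinner S (fold (reflect S) rs u) (fold (reflect S) rs v) = qinner S u v"
  using assms by (induction rs arbitrary: u v) (simp_all add: reflect_in_hilbert qinner_reflect)

text \<open>The reflection added for a new index exchanges two vectors that are both orthogonal to the
  targets reached before, and hence fixes these.\<close>

lemma exists_reflections:
  assumes S: "finite S" and I: "finite I"
    and e: "orthonormal_on S I e" and g: "orthonormal_on S I g"
  obtains rs where "\<forall>r\<in>set rs. reflector S r" "\<And>i. i \<in> I \<Longrightarrow> fold (reflect S) rs (e i) = g i"
proof -
  have "\<exists>rs. (\<forall>r\<in>set rs. reflector S r) \<and> (\<forall>i\<in>I. fold (reflect S) rs (e i) = g i)"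
    using I e g
  proof (induction I rule: finite_induct)
    case empty
    show ?case by (intro exI[of _ "[]"]) simp
  next
    case (insert i I)
    then obtain rs where rs: "\<forall>r\<in>set rs. reflector S r"
      and eq: "\<forall>j\<in>I. fold (reflect S) rs (e j) = g j"
      by (auto simp: orthonormal_on_def)
    define u where "u = fold (reflect S) rs (e i)"
    have u: "u \<in> hilbert S" "qinner S u u = 1"
      using insert.prems by (auto simp: u_def fold_reflect[OF rs] orthonormal_on_def)
    have gi: "g i \<in> hilbert S" "qinner S (g i) (g i) = 1"
      using insert.prems by (auto simp: orthonormal_on_def)
    obtain c where c: "reflector S (\<lambda>x. u x - g i x, c)" "reflect S (\<lambda>x. u x - g i x, c) u = g i"
      by (rule exists_reflector[OF S u gi])
    have "reflect S (\<lambda>x. u x - g i x, c) (g j) = g j" if j: "j \<in> I" for j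
    proof -
      \<comment> \<open>Both \<open>u\<close> and \<open>g j\<close> are images under the
        reflections in \<open>rs\<close>, so the orthogonality of \<open>e i\<close> and
        \<open>e j\<close> carries over.\<close>
      have "qinner S u (g j) = qinner S (e i) (e j)"
        using eq j fold_reflect(2)[OF rs] by (metis u_def)
      also have "\<dots> = 0" using insert.prems insert.hyps j by (auto simp: orthonormal_on_def)
      finally have "qinner S (\<lambda>x. u x - g i x) (g j) = 0"
        using insert.prems insert.hyps j by (auto simp: qinner_diff_left orthonormal_on_def)
      then show ?thesis by (simp add: reflect_def)
    qed
    then show ?case
      using rs eq c by (intro exI[of _ "rs @ [(\<lambda>x. u x - g i x, c)]"]) (auto simp: u_def)
  qed
  then show ?thesis using that by blast
qed

section \<open>Tensor products\<close>

lemma tensor_cong: "(\<And>B. B \<in> P \<Longrightarrow> f B = g B) \<Longrightarrow> tensor P f = tensor P g"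
  by (simp add: tensor_def fun_eq_iff)

text \<open>Isolating the factor of one part exhibits the tensor product as linear in that
  factor.\<close>

lemma tensor_split:
  assumes "finite P" "B \<in> P"
  shows "tensor P (f(B := v)) x = (if x \<in> bitstrings (\<Union>P)
    then v (restrict_bits B x) * (\<Prod>A\<in>P - {B}. f A (restrict_bits A x)) else 0)"
proof -
  have "(\<Prod>A\<in>P. (f(B := v)) A (restrict_bits A x))
      = (f(B := v)) B (restrict_bits B x) * (\<Prod>A\<in>P - {B}. (f(B := v)) A (restrict_bits A x))"
    by (rule prod.remove[OF assms])
  also have "\<dots> = v (restrict_bits B x) * (\<Prod>A\<in>P - {B}. f A (restrict_bits A x))"
    by simp
  finally show ?thesis by (simp add: tensor_def)
qed

lemma tensor_superposition:
  assumes "finite P" "B \<in> P"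
  shows "tensor P (f(B := (\<lambda>x. \<Sum>i\<in>I. w i * g i x)))
    = (\<lambda>x. \<Sum>i\<in>I. w i * tensor P (f(B := g i)) x)"
  using assms by (auto simp: tensor_split fun_eq_iff sum_distrib_right mult.assoc)

text \<open>If \<open>x\<close> and \<open>z\<close> differ at a qubit, one of them is set there, so
  the qubit lies in some part, and the factor of that part vanishes at \<open>x\<close>.\<close>

lemma tensor_kets:
  assumes "finite P" "z \<in> bitstrings (\<Union>P)"
  shows "tensor P (\<lambda>B. ket (restrict_bits B z)) = ket z"
proof
  fix x
  show "tensor P (\<lambda>B. ket (restrict_bits B z)) x = ket z x"
  proof (cases "x \<in> bitstrings (\<Union>P) \<and> x \<noteq> z")
    case True
    then obtain q where q: "x q \<noteq> z q" by blast
    then obtain B where B: "B \<in> P" "q \<in> B"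
      using True assms(2) unfolding bitstrings_def by blast
    have "restrict_bits B x q \<noteq> restrict_bits B z q"
      using q B(2) by (simp add: restrict_bits_def)
    then have "restrict_bits B x \<noteq> restrict_bits B z" by metis
    then have "ket (restrict_bits B z) (restrict_bits B x) = 0" by (simp add: ket_def)
    then have "(\<Prod>B\<in>P. ket (restrict_bits B z) (restrict_bits B x)) = 0"
      using assms(1) B(1) by (intro prod_zero bexI)
    then show ?thesis using True by (simp add: tensor_def ket_def)
  next
    case False
    then consider "x = z" | "x \<notin> bitstrings (\<Union>P)" "x \<noteq> z" using assms(2) by blast
    then show ?thesis using assms(2) by cases (simp_all add: tensor_def ket_def)
  qed
qed

text \<open>The product of sums expands into a sum over choices of one bit string per part. As the
  parts are disjoint, gluing and restricting identify these choices with the bit strings of the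
  union.\<close>

lemma qinner_tensor:
  assumes P: "finite P" and D: "disjoint P" and F: "\<And>B. B \<in> P \<Longrightarrow> finite B"
  shows "qinner (\<Union>P) (tensor P f) (tensor P g) = (\<Prod>B\<in>P. qinner B (f B) (g B))"
proof -
  have uniq: "B = A" if "A \<in> P" "B \<in> P" "q \<in> A" "q \<in> B" for A B q
    using D that by (auto simp: disjoint_def)
  have "(\<Prod>B\<in>P. qinner B (f B) (g B))
      = (\<Sum>h\<in>PiE P bitstrings. \<Prod>B\<in>P. cnj (f B (h B)) * g B (h B))"
    unfolding qinner_def by (rule prod_sum_PiE) (auto simp: P F finite_bitstrings)
  also have "\<dots> = (\<Sum>x\<in>bitstrings (\<Union>P). cnj (tensor P f x) * tensor P g x)"
  proof (rule sum.reindex_bij_witness[where i = "\<lambda>x. \<lambda>B\<in>P. restrict_bits B x"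
        and j = "\<lambda>h q. \<exists>B\<in>P. h B q"])
    fix h assume h: "h \<in> PiE P bitstrings"
    have hB: "q \<in> B" if "B \<in> P" "h B q" for B q
      using h that by (auto simp: PiE_def Pi_def bitstrings_def)
    have res: "restrict_bits B (\<lambda>q. \<exists>B\<in>P. h B q) = h B" if "B \<in> P" for B
      using that hB uniq by (fastforce simp: restrict_bits_def fun_eq_iff)
    show "(\<lambda>B\<in>P. restrict_bits B (\<lambda>q. \<exists>B\<in>P. h B q)) = h"
      using h res by (auto simp: fun_eq_iff PiE_def extensional_def)
    show mem: "(\<lambda>q. \<exists>B\<in>P. h B q) \<in> bitstrings (\<Union>P)"
      using hB by (auto simp: bitstrings_def)
    show "cnj (tensor P f (\<lambda>q. \<exists>B\<in>P. h B q)) * tensor P g (\<lambda>q. \<exists>B\<in>P. h B q)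
        = (\<Prod>B\<in>P. cnj (f B (h B)) * g B (h B))"
      using mem by (simp add: tensor_def res prod.distrib)
  next
    fix x assume x: "x \<in> bitstrings (\<Union>P)"
    then show "(\<lambda>q. \<exists>B\<in>P. (\<lambda>B\<in>P. restrict_bits B x) B q) = x"
      by (auto simp: fun_eq_iff restrict_bits_def bitstrings_def)
    show "(\<lambda>B\<in>P. restrict_bits B x) \<in> PiE P bitstrings" by auto
  qed
  finally show ?thesis by (simp add: qinner_def)
qed

text \<open>For \<open>i \<noteq> j\<close> every factor of the inner product is zero; at least one
  part is needed, since an empty product would be \<open>1\<close>.\<close>

lemma orthonormal_on_tensor:
  assumes P: "finite P" "disjoint P" "\<And>B. B \<in> P \<Longrightarrow> finite B" and ne: "P \<noteq> {}"
    and f: "\<And>B. B \<in> P \<Longrightarrow> orthonormal_on B I (f B)"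
  shows "orthonormal_on (\<Union>P) I (\<lambda>i. tensor P (\<lambda>B. f B i))"
  unfolding orthonormal_on_def
proof (intro conjI ballI)
  fix i j assume ij: "i \<in> I" "j \<in> I"
  have "(\<Prod>B\<in>P. qinner B (f B i) (f B j)) = (\<Prod>B\<in>P. if i = j then 1 else 0)"
    using f ij by (intro prod.cong) (auto simp: orthonormal_on_def)
  then show "qinner (\<Union>P) (tensor P (\<lambda>B. f B i)) (tensor P (\<lambda>B. f B j)) = (if i = j then 1 else 0)"
    using P ne by (simp add: qinner_tensor card_gt_0_iff)
qed (simp add: hilbert_def tensor_def)

section \<open>Circuits\<close>

lemma apply_gate_superposition:
  "apply_gate g (\<lambda>x. \<Sum>i\<in>I. w i * f i x) = (\<lambda>x. \<Sum>i\<in>I. w i * apply_gate g (f i) x)"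
proof (cases g)
  case (Local S U)
  have "(\<Sum>y\<in>bitstrings S. U (restrict_bits S x) y * (\<Sum>i\<in>I. w i * f i (override_on x y S)))
      = (\<Sum>i\<in>I. w i * (\<Sum>y\<in>bitstrings S. U (restrict_bits S x) y * f i (override_on x y S)))" for x
    unfolding sum_distrib_left by (subst sum.swap) (simp only: mult.left_commute)
  then show ?thesis unfolding Local apply_gate.simps by (rule ext)
next
  case (Straddling a b U)
  have "(\<Sum>p\<in>UNIV. U $ (x a, x b) $ p * (\<Sum>i\<in>I. w i * f i (x(a := fst p, b := snd p))))
      = (\<Sum>i\<in>I. w i * (\<Sum>p\<in>UNIV. U $ (x a, x b) $ p * f i (x(a := fst p, b := snd p))))" for x
    unfolding sum_distrib_left by (subst sum.swap) (simp only: mult.left_commute)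
  then show ?thesis unfolding Straddling apply_gate.simps case_prod_beta prod.collapse by (rule ext)
qed

lemma run_circuit_superposition:
  "run_circuit gs (\<lambda>x. \<Sum>i\<in>I. w i * f i x) = (\<lambda>x. \<Sum>i\<in>I. w i * run_circuit gs (f i) x)"
  unfolding run_circuit_def
  by (induction gs arbitrary: f) (simp_all add: apply_gate_superposition)

lemma run_circuit_append: "run_circuit (gs @ hs) \<psi> = run_circuit hs (run_circuit gs \<psi>)"
  by (simp add: run_circuit_def)

lemma straddling_count_append:
  "straddling_count (gs @ hs) = straddling_count gs + straddling_count hs"
  by (simp add: straddling_count_def)

section \<open>Local circuits on tensor products\<close>

lemma apply_local_tensor:
  assumes P: "finite P" "disjoint P" "B \<in> P"
  shows "apply_gate (Local B U) (tensor P f)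
    = tensor P (f(B := (\<lambda>x. \<Sum>y\<in>bitstrings B. U x y * f B y)))"
proof
  fix x
  \<comment> \<open>The contribution of the other parts; it is independent of \<open>y\<close>,
    because overriding bits in \<open>B\<close> affects no other part.\<close>
  let ?c = "if x \<in> bitstrings (\<Union>P) then \<Prod>A\<in>P - {B}. f A (restrict_bits A x) else 0"
  have t: "tensor P f (override_on x y B) = f B y * ?c" if y: "y \<in> bitstrings B" for y
  proof -
    have 1: "override_on x y B \<in> bitstrings (\<Union>P) \<longleftrightarrow> x \<in> bitstrings (\<Union>P)"
      using P(3) y by (auto simp: bitstrings_def override_on_def)
    have 2: "restrict_bits B (override_on x y B) = y"
      using y by (auto simp: fun_eq_iff bitstrings_def override_on_def restrict_bits_def)
    have 3: "restrict_bits A (override_on x y B) = restrict_bits A x" if "A \<in> P - {B}" for A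
      using P that by (auto simp: fun_eq_iff override_on_def restrict_bits_def disjoint_def)
    show ?thesis
      using tensor_split[OF P(1,3), of f "f B"] by (simp add: 1 2 3)
  qed
  show "apply_gate (Local B U) (tensor P f) x
      = tensor P (f(B := (\<lambda>x. \<Sum>y\<in>bitstrings B. U x y * f B y))) x"
    by (simp add: t tensor_split[OF P(1,3)] sum_distrib_right mult.assoc)
qed

lemma apply_reflect_tensor:
  assumes P: "finite P" "disjoint P" "B \<in> P" "finite B"
  shows "apply_gate (Local B (reflect_matrix r)) (tensor P f) = tensor P (f(B := reflect B r (f B)))"
  by (simp add: apply_local_tensor[OF P(1-3)] fun_eq_iff tensor_split[OF P(1,3)]
      reflect_matrix_apply[OF P(4)] del: apply_gate.simps)

lemma run_reflections_tensor:
  assumes P: "finite P" "disjoint P" "B \<in> P" "finite B"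
  shows "run_circuit (map (\<lambda>r. Local B (reflect_matrix r)) rs) (tensor P f)
    = tensor P (f(B := fold (reflect B) rs (f B)))"
  unfolding run_circuit_def
  by (induction rs arbitrary: f) (simp_all add: apply_reflect_tensor[OF P] del: apply_gate.simps)

text \<open>One circuit serves all labels \<open>i\<close> and all contents \<open>f\<close> of the
  other parts, so that it can act on superpositions by linearity.\<close>

lemma exists_local_circuit:
  assumes P: "finite P" "disjoint P" "B \<in> P" "finite B" and I: "finite I"
    and e: "orthonormal_on B I e" and g: "orthonormal_on B I g"
  obtains gs where "\<forall>h\<in>set gs. valid_gate P h" "straddling_count gs = 0"
    "\<And>i f. i \<in> I \<Longrightarrow> f B = e i \<Longrightarrow> run_circuit gs (tensor P f) = tensor P (f(B := g i))"
proof -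
  obtain rs where rs: "\<forall>r\<in>set rs. reflector B r" "\<And>i. i \<in> I \<Longrightarrow> fold (reflect B) rs (e i) = g i"
    using exists_reflections[OF P(4) I e g] by blast
  show ?thesis
  proof
    show "\<forall>h\<in>set (map (\<lambda>r. Local B (reflect_matrix r)) rs). valid_gate P h"
      using rs(1) P by (auto simp: unitary_reflect_matrix)
    show "straddling_count (map (\<lambda>r. Local B (reflect_matrix r)) rs) = 0"
      by (simp add: straddling_count_def filter_empty_conv)
    show "run_circuit (map (\<lambda>r. Local B (reflect_matrix r)) rs) (tensor P f) = tensor P (f(B := g i))"
      if "i \<in> I" "f B = e i" for i f
      using that rs(2) by (simp add: run_reflections_tensor[OF P])
  qed
qed

lemma exists_local_circuits:
  assumes P: "finite P" "disjoint P" "\<And>B. B \<in> P \<Longrightarrow> finite B" and I: "finite I"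
    and e: "\<And>B. B \<in> P \<Longrightarrow> orthonormal_on B I (e B)"
    and g: "\<And>B. B \<in> P \<Longrightarrow> orthonormal_on B I (g B)"
  obtains gs where "\<forall>h\<in>set gs. valid_gate P h" "straddling_count gs = 0"
    "\<And>i. i \<in> I \<Longrightarrow> run_circuit gs (tensor P (\<lambda>B. e B i)) = tensor P (\<lambda>B. g B i)"
proof -
  \<comment> \<open>The induction is over the set \<open>Q\<close> of parts already rotated to their
    targets.\<close>
  have "\<exists>gs. (\<forall>h\<in>set gs. valid_gate P h) \<and> straddling_count gs = 0 \<and>
      (\<forall>i\<in>I. run_circuit gs (tensor P (\<lambda>B. e B i))
        = tensor P (\<lambda>B. if B \<in> Q then g B i else e B i))"
    if "finite Q" "Q \<subseteq> P" for Q
    using that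
  proof (induction Q rule: finite_induct)
    case empty
    show ?case by (intro exI[of _ "[]"]) (simp add: run_circuit_def straddling_count_def)
  next
    case (insert B Q)
    then obtain gs where gs: "\<forall>h\<in>set gs. valid_gate P h" "straddling_count gs = 0"
      "\<forall>i\<in>I. run_circuit gs (tensor P (\<lambda>B. e B i))
        = tensor P (\<lambda>B. if B \<in> Q then g B i else e B i)"
      by auto
    have B: "B \<in> P" using insert.prems by simp
    obtain hs where hs: "\<forall>h\<in>set hs. valid_gate P h" "straddling_count hs = 0"
      "\<And>i f. i \<in> I \<Longrightarrow> f B = e B i \<Longrightarrow> run_circuit hs (tensor P f) = tensor P (f(B := g B i))"
      using exists_local_circuit[OF P(1,2) B P(3)[OF B] I e[OF B] g[OF B]] by blast
    have "(\<lambda>A. if A \<in> Q then g A i else e A i)(B := g B i)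
        = (\<lambda>A. if A \<in> insert B Q then g A i else e A i)" for i
      by auto
    then show ?case
      using gs hs insert.hyps
      by (intro exI[of _ "gs @ hs"]) (auto simp: run_circuit_append straddling_count_append)
  qed
  from this[OF P(1) order_refl] obtain gs where gs: "\<forall>h\<in>set gs. valid_gate P h"
    "straddling_count gs = 0"
    "\<forall>i\<in>I. run_circuit gs (tensor P (\<lambda>B. e B i)) = tensor P (\<lambda>B. if B \<in> P then g B i else e B i)"
    by blast
  moreover have "tensor P (\<lambda>B. if B \<in> P then g B i else e B i) = tensor P (\<lambda>B. g B i)" for i
    by (rule tensor_cong) simp
  ultimately show ?thesis using that by auto
qed

section \<open>Copying bits\<close>

text \<open>A controlled rotation by a right angle: unlike CNOT it has determinant \<open>1\<close>, and it acts as CNOT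
  as long as the target is \<open>0\<close>.\<close>

definition copy_gate :: mat4 where
  "copy_gate = (\<chi> i j. if fst i \<noteq> fst j then 0
     else if \<not> fst j then (if snd i = snd j then 1 else 0)
     else if snd i = snd j then 0 else if snd j then -1 else 1)"

text \<open>A real orthogonal square root of \<open>copy_gate\<close>; as its determinant is \<open>\<plusminus>1\<close>, that of \<open>copy_gate\<close>
  is \<open>1\<close>, without an expansion over permutations.\<close>

definition half_copy_gate :: mat4 where
  "half_copy_gate = (\<chi> i j. if fst i \<noteq> fst j then 0
     else if \<not> fst j then (if snd i = snd j then 1 else 0)
     else of_real (sqrt (1/2)) * (if snd j \<and> \<not> snd i then -1 else 1))"

text \<open>Reduces the identities between four-by-four matrices to finite case checks.\<close>

lemma sum_bool_prod:
  "(\<Sum>p\<in>UNIV. f p) = f (False, False) + f (False, True) + f (True, False) + f (True, True)"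
  for f :: "bool \<times> bool \<Rightarrow> 'a::comm_monoid_add"
  by (simp add: UNIV_Times_UNIV[symmetric] UNIV_bool sum.cartesian_product[symmetric] add_ac
      del: UNIV_Times_UNIV)

lemma half_sqrt_square: "complex_of_real (sqrt (1/2)) * complex_of_real (sqrt (1/2)) = 1/2"
  by (simp flip: of_real_mult)

lemma half_copy_gate_square: "half_copy_gate ** half_copy_gate = copy_gate"
  by (auto simp: vec_eq_iff matrix_matrix_mult_def sum_bool_prod half_copy_gate_def copy_gate_def
      half_sqrt_square)

lemma half_copy_gate_orthogonal: "half_copy_gate ** transpose half_copy_gate = mat 1"
  by (auto simp: vec_eq_iff matrix_matrix_mult_def sum_bool_prod half_copy_gate_def transpose_def
      mat_def half_sqrt_square)

lemma copy_gate_SU4: "copy_gate \<in> SU4"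
proof -
  have "det half_copy_gate * det half_copy_gate = 1"
    using arg_cong[OF half_copy_gate_orthogonal, of det] by (simp add: det_mul)
  then have "det copy_gate = 1"
    by (simp add: det_mul flip: half_copy_gate_square)
  moreover have "adjoint4 copy_gate ** copy_gate = mat 1" "copy_gate ** adjoint4 copy_gate = mat 1"
    by (auto simp: vec_eq_iff matrix_matrix_mult_def sum_bool_prod copy_gate_def adjoint4_def
        mat_def)
  ultimately show ?thesis by (simp add: SU4_def)
qed

text \<open>With the target at \<open>0\<close> only the columns with second index
  \<open>False\<close> contribute, and these contain no sign.\<close>

lemma apply_copy_gate:
  assumes "a \<noteq> b" "\<not> z b"
  shows "apply_gate (Straddling a b copy_gate) (ket z) = ket (z(b := z a))"
proof
  fix x
  have eq: "x(a := c, b := d) = z \<longleftrightarrow> c = z a \<and> \<not> d \<and> (\<forall>q. q \<noteq> a \<longrightarrow> q \<noteq> b \<longrightarrow> x q = z q)" for c d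
    using assms by (auto simp: fun_eq_iff)
  have eq': "x = z(b := z a) \<longleftrightarrow>
      x a = z a \<and> x b = z a \<and> (\<forall>q. q \<noteq> a \<longrightarrow> q \<noteq> b \<longrightarrow> x q = z q)"
    using assms by (auto simp: fun_eq_iff)
  show "apply_gate (Straddling a b copy_gate) (ket z) x = ket (z(b := z a)) x"
    by (auto simp: sum_bool_prod ket_def eq eq' copy_gate_def)
qed

text \<open>No target is ever a source, so sources keep their bits and may be reused; targets are
  distinct and initially \<open>0\<close>, so each gate acts as a copy and its result is not
  overwritten.\<close>

lemma run_copy_gates:
  assumes "distinct (map snd ps)" "fst ` set ps \<inter> snd ` set ps = {}"
    "\<And>b. b \<in> snd ` set ps \<Longrightarrow> \<not> z b"
  shows "\<exists>z'. run_circuit (map (\<lambda>(a, b). Straddling a b copy_gate) ps) (ket z) = ket z' \<and>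
    (\<forall>q. q \<notin> snd ` set ps \<longrightarrow> z' q = z q) \<and> (\<forall>a b. (a, b) \<in> set ps \<longrightarrow> z' b = z a)"
  using assms
proof (induction ps arbitrary: z)
  case Nil
  then show ?case by (auto simp: run_circuit_def)
next
  case (Cons p ps)
  obtain a b where p: "p = (a, b)" by fastforce
  have ab: "a \<noteq> b" "\<not> z b" using Cons.prems by (auto simp: p)
  have b: "b \<notin> snd ` set ps" using Cons.prems(1) by (simp add: p)
  have ps: "distinct (map snd ps)" "fst ` set ps \<inter> snd ` set ps = {}"
    using Cons.prems(1,2) by (auto simp: p)
  have fresh: "\<not> (z(b := z a)) b'" if "b' \<in> snd ` set ps" for b'
    using Cons.prems(3)[of b'] b that by (auto simp: p)
  obtain z' where
    z': "run_circuit (map (\<lambda>(a, b). Straddling a b copy_gate) ps) (ket (z(b := z a))) = ket z'"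
      "\<forall>q. q \<notin> snd ` set ps \<longrightarrow> z' q = (z(b := z a)) q"
      "\<forall>a' b'. (a', b') \<in> set ps \<longrightarrow> z' b' = (z(b := z a)) a'"
    using Cons.IH[of "z(b := z a)", OF ps fresh] by blast
  have "run_circuit (map (\<lambda>(a, b). Straddling a b copy_gate) (p # ps)) (ket z) = ket z'"
    using z'(1) by (simp add: run_circuit_def p apply_copy_gate[where z = z, OF ab] del: apply_gate.simps)
  moreover have "z' q = z q" if "q \<notin> snd ` set (p # ps)" for q
    using that z'(2) by (auto simp: p)
  moreover have "z' b' = z a'" if m: "(a', b') \<in> set (p # ps)" for a' b'
  proof (cases "(a', b') \<in> set ps")
    case True
    \<comment> \<open>The first gate has not altered the source of a later one.\<close>
    have "a' \<noteq> b" using Cons.prems(2) m by (force simp: p)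
    then show ?thesis using z'(3) True by simp
  next
    case False
    then show ?thesis using m z'(2) b by (simp add: p)
  qed
  ultimately show ?case by blast
qed

section \<open>Assembling the preparation circuit\<close>

theorem mainTheorem6:
  "\<exists>C::real. C > 0 \<and>
     (\<forall>(n::nat) (m::nat) (P :: nat set set) (\<psi> :: qvec)
        (N::nat) (w :: nat \<Rightarrow> complex) (\<phi> :: nat set \<Rightarrow> nat \<Rightarrow> qvec).
        m \<ge> 2 \<longrightarrow> partition_on {..<n} P \<longrightarrow> card P = m \<longrightarrow>
        pure_state {..<n} \<psi> \<longrightarrow> schmidt_decomposition P \<psi> N w \<phi> \<longrightarrow>
        (\<exists>gs. (\<forall>g\<in>set gs. valid_gate P g) \<and>
              run_circuit gs zero_state = \<psi> \<and>
              real (straddling_count gs) \<le> C * real m * real (schmidt_rank N w)))"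
proof (intro exI[of _ 1] conjI allI impI)
  fix n m P \<psi> N w \<phi>
  assume m: "m \<ge> 2" and part: "partition_on {..<n::nat} P" and card_P: "card P = m"
    and pure: "pure_state {..<n} \<psi>" and schmidt: "schmidt_decomposition P \<psi> N w \<phi>"
  define I where "I = {i. i < N \<and> w i \<noteq> 0}"
  define r where "r = card I"
  have I: "finite I" by (simp add: I_def)
  have UP: "\<Union>P = {..<n}" and P: "finite P" "disjoint P"
    using part by (auto simp: partition_on_def intro: finite_elements)
  have finB: "finite B" if "B \<in> P" for B
    using UP that by (metis Sup_upper finite_lessThan finite_subset)
  have "P \<noteq> {}" using m card_P by auto
  then obtain A where A: "A \<in> P" by blast
  have \<phi>: "orthonormal_on B I (\<phi> B)" if "B \<in> P" for B
    using schmidt that by (auto simp: schmidt_decomposition_def orthonormal_family_def orthonormal_on_def I_def)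
  have \<psi>: "\<psi> = (\<lambda>x. \<Sum>i\<in>I. w i * tensor P (\<lambda>B. \<phi> B i) x)"
  proof -
    have "(\<Sum>i<N. w i * tensor P (\<lambda>B. \<phi> B i) x) = (\<Sum>i\<in>I. w i * tensor P (\<lambda>B. \<phi> B i) x)" for x
      by (rule sum.mono_neutral_right) (auto simp: I_def)
    then show ?thesis using schmidt by (simp add: schmidt_decomposition_def)
  qed
  \<comment> \<open>The Schmidt terms are orthonormal across the whole system, so the norm of
    \<open>\<psi>\<close> is that of its weights.\<close>
  have w: "(\<Sum>i\<in>I. cnj (w i) * w i) = 1"
    using pure qinner_superposition[OF I orthonormal_on_tensor[OF P finB \<open>P \<noteq> {}\<close> \<phi>], of w]
    by (simp add: pure_state_def UP flip: \<psi>)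

  define k where "k = (LEAST k. r \<le> 2 ^ k)"
  \<comment> \<open>The witness for the existence of an exponent is \<open>r\<close> itself, as
    \<open>r < 2 ^ r\<close>; the same fact bounds \<open>k\<close> by \<open>r\<close>
    below.\<close>
  have k: "r \<le> 2 ^ k" unfolding k_def by (rule LeastI[of _ r]) (simp add: less_imp_le)
  have k_le: "k \<le> j" if "r \<le> 2 ^ j" for j unfolding k_def by (rule Least_le) (rule that)
  have kr: "k \<le> r" by (rule k_le) (simp add: less_imp_le)
  have kB: "k \<le> card B" if "B \<in> P" for B
    unfolding r_def using card_orthonormal_le[OF finB[OF that] I \<phi>[OF that]]
    by (intro k_le) (simp add: r_def)
  have "card I \<le> card (bitstrings {..<k})"
    using k by (simp add: r_def card_bitstrings)
  then obtain c where c: "c ` I \<subseteq> bitstrings {..<k}" "inj_on c I"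
    using card_le_inj[OF I finite_bitstrings] by blast
  \<comment> \<open>The qubit \<open>t B j\<close> is the place where part \<open>B\<close> stores
    bit \<open>j\<close> of the code \<open>c i\<close>.\<close>
  have "\<forall>B\<in>P. \<exists>t. t ` {..<k} \<subseteq> B \<and> inj_on t {..<k}"
    by (intro ballI card_le_inj) (simp_all add: kB finB)
  then obtain t where "\<forall>B\<in>P. t B ` {..<k} \<subseteq> B \<and> inj_on (t B) {..<k}"
    by (rule bchoice[THEN exE])
  then have t: "\<And>B. B \<in> P \<Longrightarrow> t B ` {..<k} \<subseteq> B" "\<And>B. B \<in> P \<Longrightarrow> inj_on (t B) {..<k}"
    by blast+
  have tB: "t B j \<in> B" if "B \<in> P" "j < k" for B j
    using t(1) that by auto
  have t_eq: "t B j = t B' j' \<longleftrightarrow> B = B' \<and> j = j'"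
    if "B \<in> P" "B' \<in> P" "j < k" "j' < k" for B B' j j'
  proof
    assume eq: "t B j = t B' j'"
    then have "B = B'"
      using that tB[of B j] tB[of B' j'] P(2) by (auto simp: disjoint_def)
    then show "B = B' \<and> j = j'"
      using eq t(2) that by (auto simp: inj_on_def)
  qed simp

  define enc where "enc = (\<lambda>B i q. \<exists>j<k. q = t B j \<and> c i j)"
  have enc_t: "enc B i (t B j) \<longleftrightarrow> c i j" if "B \<in> P" "j < k" for B i j
    using that t_eq by (auto simp: enc_def)
  have enc_in: "enc B i \<in> bitstrings B" if "B \<in> P" for B i
    using t(1)[OF that] by (auto simp: enc_def bitstrings_def)
  have enc_inj: "inj_on (enc B) I" if B: "B \<in> P" for B
  proof (rule inj_onI)
    fix i i' assume i: "i \<in> I" "i' \<in> I" and eq: "enc B i = enc B i'"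
    \<comment> \<open>Bits below \<open>k\<close> can be read off from \<open>enc B\<close>; all
      later bits of a code are \<open>False\<close>.\<close>
    have "c i j = c i' j" for j
    proof (cases "j < k")
      case True
      then show ?thesis using enc_t[OF B] eq by metis
    next
      case False
      then show ?thesis using c(1) i by (force simp: bitstrings_def)
    qed
    then have "c i = c i'" by (rule ext)
    then show "i = i'" using c(2) i by (simp add: inj_on_eq_iff)
  qed
  have enc_on: "orthonormal_on B I (\<lambda>i. ket (enc B i))" if "B \<in> P" for B
    using that by (intro orthonormal_on_kets finB enc_inj enc_in)

  define v where "v = (\<lambda>x. \<Sum>i\<in>I. w i * ket (enc A i) x)"
  have "v \<in> hilbert A"
    using enc_on[OF A] by (simp add: v_def hilbert_def orthonormal_on_def)
  \<comment> \<open>As a one-element family, the encoded superposition becomes an admissible target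
    for a local circuit on \<open>A\<close>.\<close>
  then have v: "orthonormal_on A {()} (\<lambda>_. v)"
    using qinner_superposition[OF I enc_on[OF A], of w] w by (simp add: orthonormal_on_def v_def)
  have "orthonormal_on A {()} (\<lambda>_. ket (\<lambda>_. False))"
    by (rule orthonormal_on_kets) (auto simp: finB[OF A] bitstrings_def)
  then obtain g1 where g1: "\<forall>h\<in>set g1. valid_gate P h" "straddling_count g1 = 0"
    "\<And>f. f A = ket (\<lambda>_. False) \<Longrightarrow> run_circuit g1 (tensor P f) = tensor P (f(A := v))"
    using exists_local_circuit[OF P A finB[OF A] _ _ v] by (metis finite.emptyI finite_insert insertI1)

  have ket_A: "tensor P ((\<lambda>B. ket (\<lambda>_. False))(A := ket (enc A i))) = ket (enc A i)" for i
  proof -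
    \<comment> \<open>The code sits inside \<open>A\<close>, so every other part still sees only
      zeros.\<close>
    have "restrict_bits B (enc A i) = (if B = A then enc A i else (\<lambda>_. False))" if "B \<in> P" for B
      using that A enc_in[OF A, of i] P(2)
      by (auto simp: fun_eq_iff restrict_bits_def bitstrings_def disjoint_def)
    then have "tensor P ((\<lambda>B. ket (\<lambda>_. False))(A := ket (enc A i)))
        = tensor P (\<lambda>B. ket (restrict_bits B (enc A i)))"
      by (intro tensor_cong) simp
    also have "\<dots> = ket (enc A i)"
      using A enc_in[OF A, of i] by (intro tensor_kets P) (auto simp: bitstrings_def)
    finally show ?thesis .
  qed
  have zero: "zero_state = tensor P (\<lambda>B. ket (\<lambda>_. False))"
    using tensor_kets[OF P(1), of "\<lambda>_. False"]
    by (simp add: zero_state_ket bitstrings_def restrict_bits_def)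
  have run1: "run_circuit g1 zero_state = (\<lambda>x. \<Sum>i\<in>I. w i * ket (enc A i) x)"
    unfolding zero using g1(3)[of "\<lambda>B. ket (\<lambda>_. False)"]
    by (simp add: v_def tensor_superposition[OF P(1) A] ket_A)

  define pairs where "pairs = (\<lambda>(B, j). (t A j, t B j)) ` ((P - {A}) \<times> {..<k})"
  obtain ps where ps: "set ps = pairs" "distinct ps"
    using finite_distinct_list[of pairs] P by (auto simp: pairs_def)
  \<comment> \<open>Different choices of part and bit position have different targets, although one
    source qubit of \<open>A\<close> serves all other parts.\<close>
  have "inj_on snd pairs"
    using t_eq by (auto simp: pairs_def inj_on_def)
  then have ps_distinct: "distinct (map snd ps)"
    using ps by (simp add: distinct_map)
  have ps_disj: "fst ` set ps \<inter> snd ` set ps = {}"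
    using t_eq A by (auto simp: ps pairs_def)
  have ps_fresh: "\<not> enc A i b" if "b \<in> snd ` set ps" for b i
    using that t_eq A by (auto simp: ps pairs_def enc_def)
  define g2 where "g2 = map (\<lambda>(a, b). Straddling a b copy_gate) ps"
  have run2: "run_circuit g2 (ket (enc A i)) = tensor P (\<lambda>B. ket (enc B i))" for i
  proof -
    obtain z where z: "run_circuit g2 (ket (enc A i)) = ket z"
      "\<And>q. q \<notin> snd ` set ps \<Longrightarrow> z q = enc A i q" "\<And>a b. (a, b) \<in> set ps \<Longrightarrow> z b = enc A i a"
      unfolding g2_def using run_copy_gates[OF ps_distinct ps_disj, of "enc A i"] ps_fresh by blast
    have z_t: "z (t B j) \<longleftrightarrow> c i j" if "B \<in> P" "j < k" for B j
    proof (cases "B = A")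
      case True
      then have "t B j \<notin> snd ` set ps" using that A t_eq by (auto simp: ps pairs_def)
      then show ?thesis using z(2) True enc_t that by simp
    next
      case False
      then have "(t A j, t B j) \<in> set ps" using that by (auto simp: ps pairs_def)
      then show ?thesis using z(3) enc_t[OF A] that by simp
    qed
    \<comment> \<open>Copying writes only to code qubits, and elsewhere \<open>z\<close> agrees with
      \<open>enc A i\<close>, whose set bits are code qubits of \<open>A\<close>.\<close>
    have z_out: "\<exists>B\<in>P. \<exists>j<k. q = t B j" if "z q" for q
    proof (cases "q \<in> snd ` set ps")
      case True
      then show ?thesis by (clarsimp simp: ps pairs_def) blast
    next
      case False
      then show ?thesis using z(2) that A by (auto simp: enc_def)
    qed
    have res: "restrict_bits B z = enc B i" if B: "B \<in> P" for B
    proof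
      fix q
      show "restrict_bits B z q = enc B i q"
      proof
        assume q: "restrict_bits B z q"
        then obtain B' j where q': "B' \<in> P" "j < k" "q = t B' j"
          using z_out[of q] by (auto simp: restrict_bits_def)
        then have "B' = B"
          using q B tB[of B' j] P(2) by (force simp: restrict_bits_def disjoint_def)
        then show "enc B i q" using q q' z_t by (auto simp: restrict_bits_def enc_def)
      next
        assume "enc B i q"
        then show "restrict_bits B z q" using B z_t tB by (auto simp: restrict_bits_def enc_def)
      qed
    qed
    have "z \<in> bitstrings (\<Union>P)"
      using z_out tB by (fastforce simp: bitstrings_def)
    then have "ket z = tensor P (\<lambda>B. ket (restrict_bits B z))"
      by (simp add: tensor_kets P)
    also have "\<dots> = tensor P (\<lambda>B. ket (enc B i))"
      by (rule tensor_cong) (simp add: res)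
    finally show ?thesis using z(1) by simp
  qed
  have valid2: "\<forall>h\<in>set g2. valid_gate P h"
  proof
    fix h assume "h \<in> set g2"
    then obtain B j where h: "h = Straddling (t A j) (t B j) copy_gate" and B: "B \<in> P - {A}" "j < k"
      by (auto simp: g2_def ps pairs_def)
    have "t A j \<in> A" "t B j \<in> B" "B \<in> P" "A \<noteq> B" using A B tB by auto
    then show "valid_gate P h" unfolding h valid_gate.simps using A copy_gate_SU4 by blast
  qed
  have "straddling_count g2 \<le> length ps"
    by (simp add: straddling_count_def g2_def le_trans[OF length_filter_le])
  also have "\<dots> = card pairs" using ps by (metis distinct_card)
  also have "\<dots> \<le> card ((P - {A}) \<times> {..<k})"
    unfolding pairs_def by (rule card_image_le) (simp add: P)
  also have "\<dots> \<le> m * r"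
    using kr card_P P by (simp add: card_cartesian_product) (meson card_Diff1_le mult_le_mono)
  finally have count2: "straddling_count g2 \<le> m * r" .

  obtain g3 where g3: "\<forall>h\<in>set g3. valid_gate P h" "straddling_count g3 = 0"
    "\<And>i. i \<in> I \<Longrightarrow> run_circuit g3 (tensor P (\<lambda>B. ket (enc B i))) = tensor P (\<lambda>B. \<phi> B i)"
    using exists_local_circuits[OF P finB I enc_on \<phi>] by blast
  \<comment> \<open>After \<open>g1\<close> the weights are in place; by linearity \<open>g2\<close>
    and \<open>g3\<close> can be followed on each label separately.\<close>
  have "run_circuit (g1 @ g2 @ g3) zero_state = \<psi>"
    by (simp add: run_circuit_append run1 run_circuit_superposition run2 g3(3) \<psi>)
  moreover have "straddling_count (g1 @ g2 @ g3) \<le> m * r"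
    using count2 g1(2) g3(2) by (simp add: straddling_count_append)
  then have "real (straddling_count (g1 @ g2 @ g3)) \<le> 1 * real m * real (schmidt_rank N w)"
    by (simp add: schmidt_rank_def r_def I_def flip: of_nat_mult)
  ultimately show "\<exists>gs. (\<forall>g\<in>set gs. valid_gate P g) \<and> run_circuit gs zero_state = \<psi> \<and>
      real (straddling_count gs) \<le> 1 * real m * real (schmidt_rank N w)"
    using g1(1) valid2 g3(1) by (intro exI[of _ "g1 @ g2 @ g3"]) auto
qed simp

end
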